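(* There is a linear representation $\widetilde\psi: C_n\to\mathrm{GL}(W_n)$ which is an extension of the Burau representation $\psi:B_n\to\mathrm{GL}(W_n)$, i.e. $\widetilde\psi|_{B_n}=\psi$.
   Context: Here $n\ge2$. $F_n$ is the free group on $x_1,\dots,x_n$; $C_n\le\mathrm{Aut}(F_n)$ is the group of conjugating automorphisms, i.e. those sending each $x_i$ to $f_i^{-1}x_{\pi(i)}f_i$ with $f_i\in F_n$, $\pi\in S_n$. The braid group $B_n$ is the subgroup of $C_n$ generated by the automorphisms $\sigma_i$ ($1\le i\le n-1$): $x_i\mapsto x_ix_{i+1}x_i^{-1}$, $x_{i+1}\mapsto x_i$, $x_l\mapsto x_l$ for $l\ne i,i+1$. Products of automorphisms are read from left to right, and groups act on modules on the right ($w^{gh}=(w^g)^h$), so products in $\mathrm{GL}(W_n)$ are also read from left to right. $W_n$ is the free module of rank $n$ over $\mathbb{Z}[q^{\pm1}]$ with basis $w_1,\dots,w_n$. The Burau representation $\psi$ is given by: $\sigma_i$ sends $w_i\mapsto(1-q)w_i+qw_{i+1}$, $w_{i+1}\mapsto w_i$, $w_l\mapsto w_l$ for $l\ne i,i+1$. *)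

theory Defs
  imports
    "HOL-Algebra.Bij"
    "HOL-Algebra.Generated_Groups"
    "HOL-Combinatorics.Permutations"
    "HOL-Library.Poly_Mapping"
    "Jordan_Normal_Form.Matrix"
begin

text \<open>
  Indices run over \<open>0, \<dots>, n - 1\<close> throughout: \<open>xgen i\<close>, \<open>wgen n i\<close> and \<open>braid_gen n i\<close>
  are the classical $x_{i+1}$, $w_{i+1}$ and $\sigma_{i+1}$.
\<close>

section \<open>Free groups\<close>

text \<open>
  The letter \<open>(i, True)\<close> is $x_i$ and \<open>(i, False)\<close> is $x_i^{-1}$. Group elements are reduced
  words; \<open>push\<close> multiplies a reduced word by a letter on the left and cancels if necessary.
\<close>

type_synonym letter = "nat \<times> bool"
type_synonym fword = "letter list"

definition linv :: "letter \<Rightarrow> letter" where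
  "linv a = (fst a, \<not> snd a)"

definition reduced :: "fword \<Rightarrow> bool" where
  "reduced w \<longleftrightarrow> successively (\<lambda>a b. b \<noteq> linv a) w"

fun push :: "letter \<Rightarrow> fword \<Rightarrow> fword" where
  "push a [] = [a]"
| "push a (b # w) = (if b = linv a then w else a # b # w)"

definition free_group :: "nat \<Rightarrow> fword monoid" where
  "free_group n =
    \<lparr>carrier = {w. reduced w \<and> fst ` set w \<subseteq> {..<n}},
     monoid.mult = (\<lambda>u v. foldr push u v),
     one = []\<rparr>"

definition xgen :: "nat \<Rightarrow> fword" where
  "xgen i = [(i, True)]"

text \<open>The homomorphism from a free group to \<open>G\<close> that sends each generator \<open>xgen i\<close> to \<open>g i\<close>.\<close>

definition free_lift :: "('a, 'b) monoid_scheme \<Rightarrow> (nat \<Rightarrow> 'a) \<Rightarrow> fword \<Rightarrow> 'a" where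
  "free_lift G g w =
    foldr (\<lambda>a y. (if snd a then g (fst a) else inv\<^bsub>G\<^esub> g (fst a)) \<otimes>\<^bsub>G\<^esub> y) w \<one>\<^bsub>G\<^esub>"


section \<open>Conjugating automorphisms and braids\<close>

text \<open>
  Composition in \<^const>\<open>BijGroup\<close> and \<^const>\<open>AutoGroup\<close> is the usual one, \<open>g \<otimes> f = g \<circ> f\<close>. Passing
  to the opposite group makes products of maps read from left to right.
\<close>

definition opposite_group :: "('a, 'b) monoid_scheme \<Rightarrow> 'a monoid" where
  "opposite_group G = \<lparr>carrier = carrier G, monoid.mult = (\<lambda>x y. y \<otimes>\<^bsub>G\<^esub> x), one = \<one>\<^bsub>G\<^esub>\<rparr>"

definition Aut_free :: "nat \<Rightarrow> (fword \<Rightarrow> fword) monoid" where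
  "Aut_free n = opposite_group (AutoGroup (free_group n))"

definition conj_auts :: "nat \<Rightarrow> (fword \<Rightarrow> fword) set" where
  "conj_auts n =
    {\<phi> \<in> carrier (Aut_free n).
      \<exists>\<pi> f. \<pi> permutes {..<n} \<and>
        (\<forall>i<n. f i \<in> carrier (free_group n) \<and>
          \<phi> (xgen i) =
            inv\<^bsub>free_group n\<^esub> (f i) \<otimes>\<^bsub>free_group n\<^esub> xgen (\<pi> i) \<otimes>\<^bsub>free_group n\<^esub> f i)}"

definition conj_group :: "nat \<Rightarrow> (fword \<Rightarrow> fword) monoid" where
  "conj_group n = (Aut_free n)\<lparr>carrier := conj_auts n\<rparr>"

definition braid_gen :: "nat \<Rightarrow> nat \<Rightarrow> fword \<Rightarrow> fword" where
  "braid_gen n i =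
    restrict
      (free_lift (free_group n)
        (\<lambda>l. if l = i then
               xgen i \<otimes>\<^bsub>free_group n\<^esub> xgen (Suc i) \<otimes>\<^bsub>free_group n\<^esub> inv\<^bsub>free_group n\<^esub> (xgen i)
             else if l = Suc i then xgen i
             else xgen l))
      (carrier (free_group n))"

definition braid_group :: "nat \<Rightarrow> (fword \<Rightarrow> fword) monoid" where
  "braid_group n =
    (conj_group n)\<lparr>carrier := generate (conj_group n) {braid_gen n i | i. Suc i < n}\<rparr>"


section \<open>The Burau representation\<close>

text \<open>
  The convolution ring of finitely supported functions from the additive group \<open>int\<close> to \<open>int\<close>
  is the ring of integral Laurent polynomials.
\<close>

type_synonym laurent = "int \<Rightarrow>\<^sub>0 int"

definition q :: laurent where
  "q = Poly_Mapping.single 1 1"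

definition W :: "nat \<Rightarrow> laurent vec set" where
  "W n = carrier_vec n"

definition wgen :: "nat \<Rightarrow> nat \<Rightarrow> laurent vec" where
  "wgen n i = unit_vec n i"

definition GL :: "nat \<Rightarrow> (laurent vec \<Rightarrow> laurent vec) monoid" where
  "GL n =
    (opposite_group (BijGroup (W n)))
      \<lparr>carrier :=
        {h \<in> Bij (W n).
          (\<forall>u\<in>W n. \<forall>v\<in>W n. h (u + v) = h u + h v) \<and>
          (\<forall>a. \<forall>v\<in>W n. h (a \<cdot>\<^sub>v v) = a \<cdot>\<^sub>v h v)}\<rparr>"

definition is_burau :: "nat \<Rightarrow> ((fword \<Rightarrow> fword) \<Rightarrow> laurent vec \<Rightarrow> laurent vec) \<Rightarrow> bool" where
  "is_burau n \<psi> \<longleftrightarrow>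
    \<psi> \<in> hom (braid_group n) (GL n) \<and>
    (\<forall>i. Suc i < n \<longrightarrow>
      \<psi> (braid_gen n i) (wgen n i) = (1 - q) \<cdot>\<^sub>v wgen n i + q \<cdot>\<^sub>v wgen n (Suc i) \<and>
      \<psi> (braid_gen n i) (wgen n (Suc i)) = wgen n i \<and>
      (\<forall>l<n. l \<noteq> i \<and> l \<noteq> Suc i \<longrightarrow> \<psi> (braid_gen n i) (wgen n l) = wgen n l))"

text \<open>
  At most one extensional map satisfies the description, see \<open>is_burau_unique\<close> below. That one
  exists is not part of the definition, so it has to be shown wherever \<open>burau\<close> is used.
\<close>

definition burau :: "nat \<Rightarrow> (fword \<Rightarrow> fword) \<Rightarrow> laurent vec \<Rightarrow> laurent vec" where
  "burau n = (THE \<psi>. \<psi> \<in> extensional (carrier (braid_group n)) \<and> is_burau n \<psi>)"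


section \<open>Basic facts\<close>

lemma linv_linv [simp]: "linv (linv a) = a"
  by (simp add: linv_def)

lemma fst_linv [simp]: "fst (linv a) = fst a"
  by (simp add: linv_def)

lemma linv_neq [simp]: "linv a \<noteq> a" "a \<noteq> linv a"
  by (auto simp: linv_def prod_eq_iff)

lemma reduced_Nil [simp]: "reduced []"
  by (simp add: reduced_def)

lemma reduced_Cons:
  "reduced (a # w) \<longleftrightarrow> reduced w \<and> (w = [] \<or> hd w \<noteq> linv a)"
  by (cases w) (auto simp: reduced_def)

lemma reduced_push: "reduced w \<Longrightarrow> reduced (push a w)"
  by (cases w) (auto simp: reduced_Cons)

lemma push_inverse: "reduced w \<Longrightarrow> push (linv a) (push a w) = w"
  by (cases w; cases "tl w") (auto simp: reduced_Cons)

lemma push_inverse': "reduced w \<Longrightarrow> push a (push (linv a) w) = w"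
  using push_inverse[of w "linv a"] by simp

lemma reduced_foldr_push: "reduced v \<Longrightarrow> reduced (foldr push u v)"
  by (induction u) (auto simp: reduced_push)

lemma push_letters: "set (push a w) \<subseteq> insert a (set w)"
  by (cases w) auto

lemma foldr_push_letters: "set (foldr push u v) \<subseteq> set u \<union> set v"
  by (induction u) (use push_letters in fastforce)+

lemma foldr_push_push:
  "reduced w \<Longrightarrow> foldr push (push a u) w = push a (foldr push u w)"
  by (cases u) (auto simp: push_inverse' reduced_foldr_push)

lemma foldr_push_assoc:
  "reduced w \<Longrightarrow> foldr push (foldr push u v) w = foldr push u (foldr push v w)"
  by (induction u) (auto simp: foldr_push_push)

lemma foldr_push_Nil: "reduced u \<Longrightarrow> foldr push u [] = u"
proof (induction u)
  case (Cons a u)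
  then show ?case by (cases u) (auto simp: reduced_Cons)
qed simp

lemma foldr_push_inverse: "reduced u \<Longrightarrow> foldr push (rev (map linv u)) u = []"
  by (induction u) (auto simp: reduced_Cons)

lemma linv_eq_iff: "linv a = b \<longleftrightarrow> a = linv b"
  by auto

lemma reduced_inverse: "reduced u \<Longrightarrow> reduced (rev (map linv u))"
  unfolding reduced_def successively_rev successively_map
  by (erule successively_mono) (auto simp: linv_eq_iff)

lemma group_free_group: "group (free_group n)"
proof (rule groupI)
  fix x y assume "x \<in> carrier (free_group n)" "y \<in> carrier (free_group n)"
  then have "reduced y" "fst ` (set x \<union> set y) \<subseteq> {..<n}"
    by (auto simp: free_group_def)
  then show "x \<otimes>\<^bsub>free_group n\<^esub> y \<in> carrier (free_group n)"
    using image_mono[OF foldr_push_letters[of x y], of fst]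
    by (simp add: free_group_def reduced_foldr_push)
next
  fix x assume x: "x \<in> carrier (free_group n)"
  then show "\<exists>y\<in>carrier (free_group n). y \<otimes>\<^bsub>free_group n\<^esub> x = \<one>\<^bsub>free_group n\<^esub>"
    by (intro bexI[of _ "rev (map linv x)"])
      (auto simp: free_group_def foldr_push_inverse reduced_inverse)
qed (auto simp: free_group_def foldr_push_assoc)

lemma xgen_closed: "i < n \<Longrightarrow> xgen i \<in> carrier (free_group n)"
  by (simp add: xgen_def free_group_def reduced_Cons)

lemma free_lift_xgen:
  assumes "group G" "g i \<in> carrier G"
  shows "free_lift G g (xgen i) = g i"
  using assms by (simp add: free_lift_def xgen_def group.is_monoid monoid.r_one)

lemma free_lift_hom:
  assumes G: "group G" and g: "\<And>i. i < n \<Longrightarrow> g i \<in> carrier G"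
  shows "free_lift G g \<in> hom (free_group n) G"
proof -
  interpret G: group G by (rule G)
  define l where "l a = (if snd a then g (fst a) else inv\<^bsub>G\<^esub> g (fst a))" for a
  let ?L = "free_lift G g"
  have L_Nil: "?L [] = \<one>\<^bsub>G\<^esub>" and L_Cons: "?L (a # w) = l a \<otimes>\<^bsub>G\<^esub> ?L w" for a w
    by (simp_all add: free_lift_def l_def)
  have l: "l a \<in> carrier G" if "fst a < n" for a
    using g that by (simp add: l_def)
  have closed: "?L w \<in> carrier G" if "fst ` set w \<subseteq> {..<n}" for w
    using that by (induction w) (simp_all add: L_Nil L_Cons l)
  have push: "?L (push a w) = l a \<otimes>\<^bsub>G\<^esub> ?L w"
    if a: "fst a < n" and w: "fst ` set w \<subseteq> {..<n}" for a w
  proof (cases "\<exists>v. w = linv a # v")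
    case True
    then obtain v where v: "w = linv a # v" by blast
    then have c: "?L v \<in> carrier G" using closed w by simp
    have "l a \<otimes>\<^bsub>G\<^esub> l (linv a) = \<one>\<^bsub>G\<^esub>"
      using g[OF a] by (simp add: l_def linv_def)
    moreover have "l a \<otimes>\<^bsub>G\<^esub> (l (linv a) \<otimes>\<^bsub>G\<^esub> ?L v) = (l a \<otimes>\<^bsub>G\<^esub> l (linv a)) \<otimes>\<^bsub>G\<^esub> ?L v"
      using l[of a] l[of "linv a"] a c by (simp add: G.m_assoc)
    ultimately show ?thesis using c by (simp add: v L_Cons)
  next
    case False
    then have "push a w = a # w" by (cases w) auto
    then show ?thesis by (simp add: L_Cons)
  qed
  have "?L (foldr push u v) = ?L u \<otimes>\<^bsub>G\<^esub> ?L v"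
    if u: "fst ` set u \<subseteq> {..<n}" and v: "fst ` set v \<subseteq> {..<n}" for u v
    using u
  proof (induction u)
    case Nil
    then show ?case using closed[OF v] by (simp add: L_Nil)
  next
    case (Cons a u)
    have "fst ` set (foldr push u v) \<subseteq> {..<n}"
      using image_mono[OF foldr_push_letters[of u v], of fst] Cons.prems v by fastforce
    then have "?L (foldr push (a # u) v) = l a \<otimes>\<^bsub>G\<^esub> ?L (foldr push u v)"
      using push Cons.prems by simp
    then show ?case
      using Cons l[of a] closed[of u] closed[OF v] by (simp add: G.m_assoc L_Cons)
  qed
  then show ?thesis
    by (auto simp: hom_def free_group_def intro!: closed)
qed

lemma free_hom_eqI:
  assumes G: "group G"
    and h: "h \<in> hom (free_group n) G" and k: "k \<in> hom (free_group n) G"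
    and eq: "\<And>i. i < n \<Longrightarrow> h (xgen i) = k (xgen i)"
    and w: "w \<in> carrier (free_group n)"
  shows "h w = k w"
proof -
  interpret G: group G by (rule G)
  interpret F: group "free_group n" by (rule group_free_group)
  interpret h: group_hom "free_group n" G h by unfold_locales (rule h)
  interpret k: group_hom "free_group n" G k by unfold_locales (rule k)
  have inv_x: "inv\<^bsub>free_group n\<^esub> (xgen i) = [(i, False)]" if "i < n" for i
    using that by (intro F.inv_equality)
      (auto simp: free_group_def xgen_def linv_def reduced_Cons)
  have letter: "h [a] = k [a]" if "fst a < n" for a
  proof (cases "snd a")
    case True
    then have "[a] = xgen (fst a)" by (simp add: xgen_def prod_eq_iff)
    then show ?thesis using eq that by simp
  next
    case False
    then have "[a] = inv\<^bsub>free_group n\<^esub> (xgen (fst a))"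
      using inv_x[OF that] by (simp add: prod_eq_iff)
    then show ?thesis using eq that by (simp add: xgen_closed)
  qed
  show ?thesis using w
  proof (induction w)
    case Nil
    then show ?case using h.hom_one k.hom_one by (simp add: free_group_def)
  next
    case (Cons a w)
    have c: "[a] \<in> carrier (free_group n)" "w \<in> carrier (free_group n)" "fst a < n"
      using Cons.prems by (auto simp: free_group_def reduced_Cons)
    have "a # w = [a] \<otimes>\<^bsub>free_group n\<^esub> w"
      using Cons.prems by (cases w) (auto simp: free_group_def reduced_Cons)
    then show ?case using Cons.IH c letter by (metis h.hom_mult k.hom_mult)
  qed
qed

lemma group_opposite_group:
  assumes "group G"
  shows "group (opposite_group G)"
proof -
  interpret G: group G by (rule assms)
  show ?thesis
  proof (rule groupI)
    fix x assume "x \<in> carrier (opposite_group G)"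
    then show "\<exists>y\<in>carrier (opposite_group G). y \<otimes>\<^bsub>opposite_group G\<^esub> x = \<one>\<^bsub>opposite_group G\<^esub>"
      by (intro bexI[of _ "inv\<^bsub>G\<^esub> x"]) (auto simp: opposite_group_def)
  qed (auto simp: opposite_group_def G.m_assoc)
qed

lemma group_Aut_free: "group (Aut_free n)"
  unfolding Aut_free_def
  by (intro group_opposite_group group.AutoGroup group_free_group)

lemma Aut_free_carrier: "carrier (Aut_free n) = auto (free_group n)"
  by (simp add: Aut_free_def opposite_group_def AutoGroup_def)

lemma Aut_free_mult:
  "\<lbrakk>\<phi> \<in> auto (free_group n); \<chi> \<in> auto (free_group n)\<rbrakk> \<Longrightarrow>
    \<phi> \<otimes>\<^bsub>Aut_free n\<^esub> \<chi> = compose (carrier (free_group n)) \<chi> \<phi>"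
  by (simp add: Aut_free_def opposite_group_def AutoGroup_def BijGroup_def auto_def)

lemma Aut_free_one: "\<one>\<^bsub>Aut_free n\<^esub> = (\<lambda>w\<in>carrier (free_group n). w)"
  by (simp add: Aut_free_def opposite_group_def AutoGroup_def BijGroup_def)

lemma subgroup_conj_auts: "subgroup (conj_auts n) (Aut_free n)"
proof -
  interpret A: group "Aut_free n" by (rule group_Aut_free)
  interpret F: group "free_group n" by (rule group_free_group)
  have aut: "group_hom (free_group n) (free_group n) \<phi>" if "\<phi> \<in> auto (free_group n)" for \<phi>
    using that by unfold_locales (simp add: auto_def)
  show ?thesis
  proof (rule A.subgroupI)
    show "conj_auts n \<subseteq> carrier (Aut_free n)" by (auto simp: conj_auts_def)
    have "\<one>\<^bsub>Aut_free n\<^esub> \<in> conj_auts n"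
      unfolding conj_auts_def using A.one_closed
      by (auto intro!: exI[of _ id] exI[of _ "\<lambda>_. \<one>\<^bsub>free_group n\<^esub>"]
          simp: permutes_id Aut_free_one xgen_closed)
    then show "conj_auts n \<noteq> {}" by blast
  next
    fix \<phi> assume "\<phi> \<in> conj_auts n"
    then obtain \<pi> f where \<phi>: "\<phi> \<in> auto (free_group n)" and \<pi>: "\<pi> permutes {..<n}"
      and f: "\<And>i. i < n \<Longrightarrow> f i \<in> carrier (free_group n)"
      and eq: "\<And>i. i < n \<Longrightarrow> \<phi> (xgen i) =
        inv\<^bsub>free_group n\<^esub> (f i) \<otimes>\<^bsub>free_group n\<^esub> xgen (\<pi> i) \<otimes>\<^bsub>free_group n\<^esub> f i"
      unfolding conj_auts_def Aut_free_carrier by blast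
    define \<rho> where "\<rho> = inv_into UNIV \<pi>"
    have \<rho>: "\<rho> permutes {..<n}" "\<pi> (\<rho> j) = j" for j
      using permutes_inv[OF \<pi>] permutes_inverses(1)[OF \<pi>] by (simp_all add: \<rho>_def)
    define \<eta> where "\<eta> = inv\<^bsub>Aut_free n\<^esub> \<phi>"
    have \<eta>: "\<eta> \<in> auto (free_group n)"
      using A.inv_closed[of \<phi>] \<phi> by (simp add: \<eta>_def Aut_free_carrier)
    interpret \<eta>: group_hom "free_group n" "free_group n" \<eta> by (rule aut[OF \<eta>])
    have "compose (carrier (free_group n)) \<eta> \<phi> = (\<lambda>w\<in>carrier (free_group n). w)"
      using A.r_inv[of \<phi>] \<phi> \<eta> Aut_free_mult[OF \<phi> \<eta>] Aut_free_one[of n]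
      by (simp add: \<eta>_def Aut_free_carrier)
    then have \<eta>\<phi>: "\<eta> (\<phi> w) = w" if "w \<in> carrier (free_group n)" for w
      using that by (metis compose_eq restrict_apply')
    have "\<eta> (xgen j) = inv\<^bsub>free_group n\<^esub> (inv\<^bsub>free_group n\<^esub> (\<eta> (f (\<rho> j)))) \<otimes>\<^bsub>free_group n\<^esub>
        xgen (\<rho> j) \<otimes>\<^bsub>free_group n\<^esub> inv\<^bsub>free_group n\<^esub> (\<eta> (f (\<rho> j)))"
      if j: "j < n" for j
    proof -
      define i where "i = \<rho> j"
      have i: "i < n" "\<pi> i = j"
        using permutes_in_image[OF \<rho>(1), of j] j \<rho>(2) by (auto simp: i_def)
      have x: "xgen j \<in> carrier (free_group n)" using j by (rule xgen_closed)
      have "xgen i = \<eta> (inv\<^bsub>free_group n\<^esub> (f i) \<otimes>\<^bsub>free_group n\<^esub> xgen j \<otimes>\<^bsub>free_group n\<^esub> f i)"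
        using \<eta>\<phi>[OF xgen_closed[OF i(1)]] eq[OF i(1)] i(2) by simp
      also have "\<dots> = inv\<^bsub>free_group n\<^esub> \<eta> (f i) \<otimes>\<^bsub>free_group n\<^esub> \<eta> (xgen j) \<otimes>\<^bsub>free_group n\<^esub> \<eta> (f i)"
        using f[OF i(1)] x by simp
      finally show ?thesis
        unfolding i_def[symmetric] using f[OF i(1)] x
        by (simp add: F.m_assoc F.inv_solve_left' F.r_inv) 
          (simp add: F.m_assoc[symmetric])
    qed
    moreover have "\<eta> (f (\<rho> j)) \<in> carrier (free_group n)" if "j < n" for j
      using permutes_in_image[OF \<rho>(1), of j] that f by simp
    ultimately show "inv\<^bsub>Aut_free n\<^esub> \<phi> \<in> conj_auts n"
      unfolding conj_auts_def Aut_free_carrier \<eta>_def[symmetric]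
      using \<eta> \<rho>(1)
      by (intro CollectI conjI exI[of _ "\<rho>"]
          exI[of _ "\<lambda>j. inv\<^bsub>free_group n\<^esub> (\<eta> (f (\<rho> j)))"]) auto
  next
    fix \<phi> \<chi> assume "\<phi> \<in> conj_auts n" "\<chi> \<in> conj_auts n"
    then obtain \<pi> f \<rho> h where \<phi>: "\<phi> \<in> auto (free_group n)" and \<pi>: "\<pi> permutes {..<n}"
      and f: "\<And>i. i < n \<Longrightarrow> f i \<in> carrier (free_group n)"
      and eq: "\<And>i. i < n \<Longrightarrow> \<phi> (xgen i) =
        inv\<^bsub>free_group n\<^esub> (f i) \<otimes>\<^bsub>free_group n\<^esub> xgen (\<pi> i) \<otimes>\<^bsub>free_group n\<^esub> f i"
      and \<chi>: "\<chi> \<in> auto (free_group n)" and \<rho>: "\<rho> permutes {..<n}"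
      and h: "\<And>i. i < n \<Longrightarrow> h i \<in> carrier (free_group n)"
      and eq': "\<And>i. i < n \<Longrightarrow> \<chi> (xgen i) =
        inv\<^bsub>free_group n\<^esub> (h i) \<otimes>\<^bsub>free_group n\<^esub> xgen (\<rho> i) \<otimes>\<^bsub>free_group n\<^esub> h i"
      unfolding conj_auts_def Aut_free_carrier by blast
    interpret \<chi>: group_hom "free_group n" "free_group n" \<chi> by (rule aut[OF \<chi>])
    have "(\<phi> \<otimes>\<^bsub>Aut_free n\<^esub> \<chi>) (xgen i) =
        inv\<^bsub>free_group n\<^esub> (h (\<pi> i) \<otimes>\<^bsub>free_group n\<^esub> \<chi> (f i)) \<otimes>\<^bsub>free_group n\<^esub> xgen ((\<rho> \<circ> \<pi>) i)
          \<otimes>\<^bsub>free_group n\<^esub> (h (\<pi> i) \<otimes>\<^bsub>free_group n\<^esub> \<chi> (f i))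
        \<and> h (\<pi> i) \<otimes>\<^bsub>free_group n\<^esub> \<chi> (f i) \<in> carrier (free_group n)" if i: "i < n" for i
    proof -
      have "\<pi> i < n" "\<rho> (\<pi> i) < n"
        using permutes_in_image[OF \<pi>, of i] permutes_in_image[OF \<rho>, of "\<pi> i"] i by auto
      then show ?thesis
        using i f[OF i] h[of "\<pi> i"] xgen_closed[of "\<pi> i" n] xgen_closed[of "\<rho> (\<pi> i)" n]
        by (simp add: Aut_free_mult[OF \<phi> \<chi>] compose_eq xgen_closed eq eq'
            F.inv_mult_group F.m_assoc)
    qed
    then show "\<phi> \<otimes>\<^bsub>Aut_free n\<^esub> \<chi> \<in> conj_auts n"
      unfolding conj_auts_def
      using A.m_closed[of \<phi> \<chi>] \<phi> \<chi> permutes_compose[OF \<pi> \<rho>]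
      by (intro CollectI conjI exI[of _ "\<rho> \<circ> \<pi>"]
          exI[of _ "\<lambda>i. h (\<pi> i) \<otimes>\<^bsub>free_group n\<^esub> \<chi> (f i)"]) (auto simp: Aut_free_carrier)
  qed
qed

lemma group_conj_group: "group (conj_group n)"
  unfolding conj_group_def
  by (rule subgroup.subgroup_is_group[OF subgroup_conj_auts group_Aut_free])

lemma braid_gen_xgen:
  assumes "Suc i < n"
  shows "braid_gen n i (xgen i) =
      xgen i \<otimes>\<^bsub>free_group n\<^esub> xgen (Suc i) \<otimes>\<^bsub>free_group n\<^esub> inv\<^bsub>free_group n\<^esub> (xgen i)"
    and "braid_gen n i (xgen (Suc i)) = xgen i"
    and "\<lbrakk>l < n; l \<noteq> i; l \<noteq> Suc i\<rbrakk> \<Longrightarrow> braid_gen n i (xgen l) = xgen l"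
proof -
  interpret F: group "free_group n" by (rule group_free_group)
  show "braid_gen n i (xgen i) =
      xgen i \<otimes>\<^bsub>free_group n\<^esub> xgen (Suc i) \<otimes>\<^bsub>free_group n\<^esub> inv\<^bsub>free_group n\<^esub> (xgen i)"
    and "braid_gen n i (xgen (Suc i)) = xgen i"
    and "\<lbrakk>l < n; l \<noteq> i; l \<noteq> Suc i\<rbrakk> \<Longrightarrow> braid_gen n i (xgen l) = xgen l"
    using assms by (simp_all add: braid_gen_def xgen_closed free_lift_xgen[OF F.group_axioms])
qed

lemma braid_gen_hom:
  assumes "Suc i < n"
  shows "braid_gen n i \<in> hom (free_group n) (free_group n)"
proof -
  interpret F: group "free_group n" by (rule group_free_group)
  let ?g = "\<lambda>l. if l = i then
      xgen i \<otimes>\<^bsub>free_group n\<^esub> xgen (Suc i) \<otimes>\<^bsub>free_group n\<^esub> inv\<^bsub>free_group n\<^esub> (xgen i)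
    else if l = Suc i then xgen i else xgen l"
  have "free_lift (free_group n) ?g \<in> hom (free_group n) (free_group n)"
    using assms by (intro free_lift_hom F.group_axioms) (simp add: xgen_closed)
  then show ?thesis
    unfolding braid_gen_def by (auto simp: hom_def Pi_iff)
qed

lemma braid_gen_auto:
  assumes i: "Suc i < n"
  shows "braid_gen n i \<in> auto (free_group n)"
proof -
  interpret F: group "free_group n" by (rule group_free_group)
  define g where "g l =
     (if l = i then xgen (Suc i)
      else if l = Suc i then
        inv\<^bsub>free_group n\<^esub> (xgen (Suc i)) \<otimes>\<^bsub>free_group n\<^esub> xgen i \<otimes>\<^bsub>free_group n\<^esub> xgen (Suc i)
      else xgen l)" for l
  define \<tau> where "\<tau> = free_lift (free_group n) g"
  have x: "xgen i \<in> carrier (free_group n)" "xgen (Suc i) \<in> carrier (free_group n)"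
    using i by (auto intro: xgen_closed)
  have gc: "g l \<in> carrier (free_group n)" if "l < n" for l
    using that x by (simp add: g_def xgen_closed)
  interpret \<tau>: group_hom "free_group n" "free_group n" \<tau>
    unfolding \<tau>_def by unfold_locales (intro free_lift_hom F.group_axioms gc)
  interpret \<sigma>: group_hom "free_group n" "free_group n" "braid_gen n i"
    by unfold_locales (rule braid_gen_hom[OF i])
  have \<tau>x: "\<tau> (xgen l) = g l" if "l < n" for l
    unfolding \<tau>_def using that by (intro free_lift_xgen F.group_axioms gc)
  have cancel: "a \<otimes>\<^bsub>free_group n\<^esub> (inv\<^bsub>free_group n\<^esub> a \<otimes>\<^bsub>free_group n\<^esub> b) = b"
      "inv\<^bsub>free_group n\<^esub> a \<otimes>\<^bsub>free_group n\<^esub> (a \<otimes>\<^bsub>free_group n\<^esub> b) = b"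
    if "a \<in> carrier (free_group n)" "b \<in> carrier (free_group n)" for a b
    using that by (simp_all flip: F.m_assoc)
  have id: "id \<in> hom (free_group n) (free_group n)" by (simp add: hom_def)
  have "(\<tau> \<circ> braid_gen n i) w = id w" if "w \<in> carrier (free_group n)" for w
  proof (rule free_hom_eqI[OF F.group_axioms _ id _ that])
    show "\<tau> \<circ> braid_gen n i \<in> hom (free_group n) (free_group n)"
      by (rule hom_compose[OF \<sigma>.homh \<tau>.homh])
    fix l assume "l < n"
    then show "(\<tau> \<circ> braid_gen n i) (xgen l) = id (xgen l)"
      using i x braid_gen_xgen[OF i] cancel
      by (cases "l = i \<or> l = Suc i") (auto simp: \<tau>x g_def F.m_assoc)
  qed
  moreover have "(braid_gen n i \<circ> \<tau>) w = id w" if "w \<in> carrier (free_group n)" for w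
  proof (rule free_hom_eqI[OF F.group_axioms _ id _ that])
    show "braid_gen n i \<circ> \<tau> \<in> hom (free_group n) (free_group n)"
      by (rule hom_compose[OF \<tau>.homh \<sigma>.homh])
    fix l assume "l < n"
    then show "(braid_gen n i \<circ> \<tau>) (xgen l) = id (xgen l)"
      using i x braid_gen_xgen[OF i] cancel
      by (cases "l = i \<or> l = Suc i") (auto simp: \<tau>x g_def F.m_assoc)
  qed
  ultimately have "bij_betw (braid_gen n i) (carrier (free_group n)) (carrier (free_group n))"
    by (intro bij_betwI[of _ _ _ \<tau>]) auto
  then show ?thesis
    using braid_gen_hom[OF i] by (simp add: auto_def Bij_def braid_gen_def)
qed

lemma braid_gen_conj:
  assumes i: "Suc i < n"
  shows "braid_gen n i \<in> carrier (conj_group n)"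
proof -
  interpret F: group "free_group n" by (rule group_free_group)
  let ?f = "\<lambda>l. if l = i then inv\<^bsub>free_group n\<^esub> (xgen i) else \<one>\<^bsub>free_group n\<^esub>"
  have "transpose i (Suc i) permutes {..<n}"
    using i by (intro permutes_swap_id) auto
  moreover have "?f l \<in> carrier (free_group n) \<and> braid_gen n i (xgen l) =
      inv\<^bsub>free_group n\<^esub> (?f l) \<otimes>\<^bsub>free_group n\<^esub> xgen (transpose i (Suc i) l) \<otimes>\<^bsub>free_group n\<^esub> ?f l"
    if "l < n" for l
    using that i braid_gen_xgen[OF i] by (auto simp: transpose_def xgen_closed)
  ultimately show ?thesis
    using braid_gen_auto[OF i] unfolding conj_group_def conj_auts_def
    by (auto simp: Aut_free_carrier simp del: F.inv_closed
        intro!: exI[of _ "transpose i (Suc i)"] exI[of _ ?f])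
qed

lemma subgroup_braid_group: "subgroup (carrier (braid_group n)) (conj_group n)"
proof -
  have "subgroup (generate (conj_group n) {braid_gen n i | i. Suc i < n}) (conj_group n)"
    by (rule group.generate_is_subgroup[OF group_conj_group]) (use braid_gen_conj in blast)
  then show ?thesis by (simp add: braid_group_def)
qed

lemma group_braid_group: "group (braid_group n)"
  using subgroup.subgroup_is_group[OF subgroup_braid_group group_conj_group, of n]
  by (simp add: braid_group_def)

lemma subgroup_GL: "subgroup (carrier (GL n)) (opposite_group (BijGroup (W n)))"
proof -
  interpret B: group "opposite_group (BijGroup (W n))"
    by (rule group_opposite_group[OF group_BijGroup])
  have inv: "inv\<^bsub>opposite_group (BijGroup (W n))\<^esub> h = (\<lambda>x\<in>W n. inv_into (W n) h x)"
    if h: "h \<in> Bij (W n)" for h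
  proof (rule B.inv_equality)
    show "(\<lambda>x\<in>W n. inv_into (W n) h x) \<otimes>\<^bsub>opposite_group (BijGroup (W n))\<^esub> h =
        \<one>\<^bsub>opposite_group (BijGroup (W n))\<^esub>"
      using group.r_inv[OF group_BijGroup, of h "W n"] h
      unfolding inv_BijGroup[OF h] by (simp add: opposite_group_def BijGroup_def)
  qed (use h in \<open>auto simp: opposite_group_def BijGroup_def restrict_inv_into_Bij\<close>)
  show ?thesis
  proof (rule B.subgroupI)
    show "carrier (GL n) \<subseteq> carrier (opposite_group (BijGroup (W n)))"
      by (auto simp: GL_def opposite_group_def BijGroup_def)
    have "(\<lambda>x\<in>W n. x) \<in> carrier (GL n)"
      by (auto simp: GL_def id_Bij W_def)
    then show "carrier (GL n) \<noteq> {}" by blast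
  next
    fix h assume "h \<in> carrier (GL n)"
    then have h: "h \<in> Bij (W n)"
      and add: "\<And>u v. u \<in> W n \<Longrightarrow> v \<in> W n \<Longrightarrow> h (u + v) = h u + h v"
      and smult: "\<And>a v. v \<in> W n \<Longrightarrow> h (a \<cdot>\<^sub>v v) = a \<cdot>\<^sub>v h v"
      by (auto simp: GL_def)
    have img: "h ` W n = W n" and inj: "inj_on h (W n)"
      using h by (auto simp: Bij_def bij_betw_def)
    define k where "k = inv_into (W n) h"
    have k: "k v \<in> W n" "h (k v) = v" if "v \<in> W n" for v
      using that img by (auto simp: k_def inv_into_into f_inv_into_f)
    have kh: "k (h v) = v" if "v \<in> W n" for v
      using that inj by (simp add: k_def)
    have W: "u + v \<in> W n" "a \<cdot>\<^sub>v u \<in> W n" if "u \<in> W n" "v \<in> W n" for u v a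
      using that by (auto simp: W_def)
    have "k (u + v) = k u + k v" if "u \<in> W n" "v \<in> W n" for u v
      using kh[of "k u + k v"] add[of "k u" "k v"] k W that by simp
    moreover have "k (a \<cdot>\<^sub>v v) = a \<cdot>\<^sub>v k v" if "v \<in> W n" for a v
      using kh[of "a \<cdot>\<^sub>v k v"] smult[of "k v" a] k W[of "k v" "k v"] that by simp
    ultimately show "inv\<^bsub>opposite_group (BijGroup (W n))\<^esub> h \<in> carrier (GL n)"
      unfolding inv[OF h] using restrict_inv_into_Bij[OF h] W
      by (simp add: GL_def k_def)
  next
    fix h k assume "h \<in> carrier (GL n)" "k \<in> carrier (GL n)"
    moreover from this have "h \<in> W n \<rightarrow> W n" "k \<in> W n \<rightarrow> W n"
      by (auto simp: GL_def dest: Bij_imp_funcset)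
    ultimately show "h \<otimes>\<^bsub>opposite_group (BijGroup (W n))\<^esub> k \<in> carrier (GL n)"
      by (auto simp: GL_def opposite_group_def BijGroup_def compose_Bij compose_eq W_def Pi_iff)
  qed
qed

lemma group_GL: "group (GL n)"
  using subgroup.subgroup_is_group[OF subgroup_GL group_opposite_group[OF group_BijGroup], of n]
  by (simp add: GL_def)

lemma GL_eqI:
  assumes h: "h \<in> carrier (GL n)" and k: "k \<in> carrier (GL n)"
    and eq: "\<And>i. i < n \<Longrightarrow> h (wgen n i) = k (wgen n i)"
  shows "h = k"
proof (rule extensionalityI)
  show "h \<in> extensional (W n)" "k \<in> extensional (W n)"
    using h k by (auto simp: GL_def Bij_def)
  fix v assume v: "v \<in> W n"
  define t where "t m = vec n (\<lambda>j. if j < m then v $ j else 0)" for m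
  have W: "t m \<in> W n" "wgen n m \<in> W n" "v $ m \<cdot>\<^sub>v wgen n m \<in> W n" for m
    by (simp_all add: W_def wgen_def t_def)
  have "h (t m) = k (t m)" if "m \<le> n" for m
    using that
  proof (induction m)
    case 0
    have z: "t 0 = 0 \<cdot>\<^sub>v v"
      using v by (intro eq_vecI) (simp_all add: W_def t_def)
    have zero: "f (t 0) = 0\<^sub>v n" if f: "f \<in> carrier (GL n)" for f
    proof -
      have "f v \<in> W n"
        using f v by (auto simp: GL_def dest: Bij_imp_funcset)
      moreover have "f (t 0) = 0 \<cdot>\<^sub>v f v"
        using f v unfolding z by (simp add: GL_def)
      ultimately show ?thesis by (intro eq_vecI) (simp_all add: W_def)
    qed
    show ?case by (simp only: zero[OF h] zero[OF k])
  next
    case (Suc m)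
    have s: "t (Suc m) = t m + v $ m \<cdot>\<^sub>v wgen n m"
      using Suc.prems by (intro eq_vecI) (simp_all add: wgen_def t_def less_Suc_eq)
    have step: "f (t m + v $ m \<cdot>\<^sub>v wgen n m) = f (t m) + v $ m \<cdot>\<^sub>v f (wgen n m)"
      if "f \<in> carrier (GL n)" for f
      using that W[of m] by (simp add: GL_def)
    have "h (t m) = k (t m)" "h (wgen n m) = k (wgen n m)"
      using Suc eq[of m] by simp_all
    then show ?case by (simp only: s step[OF h] step[OF k])
  qed
  moreover have "t n = v"
    using v by (intro eq_vecI) (simp_all add: W_def t_def)
  ultimately show "h v = k v" by fastforce
qed

lemma is_burau_unique:
  assumes \<psi>: "is_burau n \<psi>" "\<psi> \<in> extensional (carrier (braid_group n))"
    and \<psi>': "is_burau n \<psi>'" "\<psi>' \<in> extensional (carrier (braid_group n))"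
  shows "\<psi> = \<psi>'"
proof (rule extensionalityI[OF \<psi>(2) \<psi>'(2)])
  interpret B: group "braid_group n" by (rule group_braid_group)
  interpret \<psi>: group_hom "braid_group n" "GL n" \<psi>
    using \<psi>(1) group_GL[of n]
    by (intro group_hom.intro group_hom_axioms.intro B.group_axioms) (simp_all add: is_burau_def)
  interpret \<psi>': group_hom "braid_group n" "GL n" \<psi>'
    using \<psi>'(1) by unfold_locales (simp add: is_burau_def)
  fix b assume "b \<in> carrier (braid_group n)"
  then have "b \<in> generate (conj_group n) {braid_gen n i |i. Suc i < n}"
    by (simp add: braid_group_def)
  then show "\<psi> b = \<psi>' b"
  proof (induction rule: generate.induct)
    case one
    then show ?case using \<psi>.hom_one \<psi>'.hom_one by (simp add: braid_group_def)
  next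
    case gen: (incl h)
    then obtain i where i: "Suc i < n" "h = braid_gen n i" by blast
    have h: "h \<in> carrier (braid_group n)"
      using generate.incl[OF gen] by (simp add: braid_group_def)
    show ?case
    proof (rule GL_eqI[OF \<psi>.hom_closed[OF h] \<psi>'.hom_closed[OF h]])
      fix l assume "l < n"
      then show "\<psi> h (wgen n l) = \<psi>' h (wgen n l)"
        using \<psi>(1) \<psi>'(1) i unfolding is_burau_def
        by (cases "l = i \<or> l = Suc i") auto
    qed
  next
    case gen: (inv h)
    then obtain i where i: "Suc i < n" "h = braid_gen n i" by blast
    have h: "h \<in> carrier (braid_group n)"
      using generate.incl[OF gen] by (simp add: braid_group_def)
    have "\<psi> h = \<psi>' h"
    proof (rule GL_eqI[OF \<psi>.hom_closed[OF h] \<psi>'.hom_closed[OF h]])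
      fix l assume "l < n"
      then show "\<psi> h (wgen n l) = \<psi>' h (wgen n l)"
        using \<psi>(1) \<psi>'(1) i unfolding is_burau_def
        by (cases "l = i \<or> l = Suc i") auto
    qed
    moreover have "inv\<^bsub>conj_group n\<^esub> h = inv\<^bsub>braid_group n\<^esub> h"
      using group.m_inv_consistent[OF group_conj_group subgroup_braid_group h]
      by (simp add: braid_group_def)
    ultimately show ?case using h by simp
  next
    case (eng h k)
    then have "h \<in> carrier (braid_group n)" "k \<in> carrier (braid_group n)"
      "h \<otimes>\<^bsub>conj_group n\<^esub> k = h \<otimes>\<^bsub>braid_group n\<^esub> k"
      by (auto simp: braid_group_def)
    then show ?case using eng.IH by simp
  qed
qed

end

theory Submission
  imports Defs
begin

text \<open>
  The Burau representation is the Magnus representation given by Fox calculus. Specialise the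
  Fox derivatives $\partial/\partial x_j$ of the free group by sending every generator to $q$;
  written as a vector, the gradient of a word is then a crossed homomorphism
  $D(uv) = D(u) + q^{\deg u} D(v)$, where \<open>deg\<close> is the exponent sum. For an automorphism \<open>\<phi>\<close>
  let $M_\phi$ be the linear map with $M_\phi w_i = D(\phi(x_i))$.

  A conjugating automorphism sends each generator to a conjugate of a generator, hence
  preserves exponent sums. For such \<open>\<phi>\<close> the chain rule takes the untwisted form
  $D(\phi(u)) = M_\phi(D(u))$ (\<open>fox_chain_rule\<close>), because the ring automorphism by which the
  chain rule is twisted in general becomes the identity. Applied to $u = \chi(x_i)$ it says
  that \<open>M\<close> turns composition of automorphisms into composition of linear maps
  (\<open>magnus_mat_compose\<close>). Both groups read products from left to right, so \<open>M\<close> is a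
  homomorphism, and its values are invertible because the group elements are.

  Finally $D(x_i x_{i+1} x_i^{-1}) = (1 - q) w_i + q w_{i+1}$, so on the generators of the braid
  group \<open>M\<close> is given by the Burau formulas. The restriction of \<open>M\<close> therefore witnesses that
  the Burau representation exists, and it equals it by uniqueness.
\<close>

section \<open>Exponent sums and powers of the parameter\<close>

definition letter_deg :: "letter \<Rightarrow> int" where
  "letter_deg a = (if snd a then 1 else - 1)"

definition word_deg :: "fword \<Rightarrow> int" where
  "word_deg w = (\<Sum>a\<leftarrow>w. letter_deg a)"

definition q_pow :: "int \<Rightarrow> laurent" where
  "q_pow k = Poly_Mapping.single k 1"

lemma q_pow_0 [simp]: "q_pow 0 = 1"
  by (simp add: q_pow_def)

lemma q_pow_1: "q_pow 1 = q"
  by (simp add: q_pow_def q_def)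

lemma q_pow_add: "q_pow (k + l) = q_pow k * q_pow l"
  by (simp add: q_pow_def mult_single)

lemma q_pow_inverse: "q_pow (- k) * q_pow k = 1" "q_pow k * q_pow (- k) = 1"
  by (simp_all flip: q_pow_add)

lemma letter_deg_linv: "letter_deg (linv a) = - letter_deg a"
  by (simp add: letter_deg_def linv_def)

lemma word_deg_Nil [simp]: "word_deg [] = 0"
  and word_deg_Cons [simp]: "word_deg (a # w) = letter_deg a + word_deg w"
  by (simp_all add: word_deg_def)

lemma word_deg_push: "word_deg (push a w) = letter_deg a + word_deg w"
  by (cases w) (auto simp: letter_deg_linv)

lemma word_deg_mult: "word_deg (u \<otimes>\<^bsub>free_group n\<^esub> v) = word_deg u + word_deg v"
  by (induction u) (simp_all add: free_group_def word_deg_push)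

lemma word_deg_inv:
  assumes "u \<in> carrier (free_group n)"
  shows "word_deg (inv\<^bsub>free_group n\<^esub> u) = - word_deg u"
proof -
  interpret F: group "free_group n" by (rule group_free_group)
  have "word_deg (inv\<^bsub>free_group n\<^esub> u) + word_deg u = word_deg \<one>\<^bsub>free_group n\<^esub>"
    using assms by (simp flip: word_deg_mult[where n = n])
  then show ?thesis by (simp add: free_group_def)
qed

lemma word_deg_xgen: "word_deg (xgen i) = 1"
  by (simp add: xgen_def letter_deg_def)


section \<open>Fox derivatives\<close>

text \<open>
  The value for an inverse letter is forced by the product rule applied to
  $x_j^{-1} x_j = 1$.
\<close>

definition letter_fox :: "nat \<Rightarrow> letter \<Rightarrow> laurent" where
  "letter_fox j a = (if fst a = j then if snd a then 1 else - q_pow (- 1) else 0)"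

text \<open>
  The Fox derivative $\partial w/\partial x_j$, normally an element of the integral group ring
  of the free group, with every generator specialised to $q$.
\<close>

fun fox :: "nat \<Rightarrow> fword \<Rightarrow> laurent" where
  "fox j [] = 0"
| "fox j (a # w) = letter_fox j a + q_pow (letter_deg a) * fox j w"

lemma letter_fox_linv:
  "letter_fox j a + q_pow (letter_deg a) * letter_fox j (linv a) = 0"
  by (auto simp: letter_fox_def letter_deg_def linv_def q_pow_inverse)

lemma fox_push: "fox j (push a w) = letter_fox j a + q_pow (letter_deg a) * fox j w"
proof (cases "\<exists>v. w = linv a # v")
  case True
  then obtain v where w: "w = linv a # v" by blast
  have "letter_fox j a + q_pow (letter_deg a) * fox j w =
      (letter_fox j a + q_pow (letter_deg a) * letter_fox j (linv a)) +
      (q_pow (letter_deg a) * q_pow (- letter_deg a)) * fox j v"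
    by (simp add: w letter_deg_linv algebra_simps)
  then show ?thesis by (simp add: w letter_fox_linv q_pow_inverse)
next
  case False
  then have "push a w = a # w" by (cases w) auto
  then show ?thesis by simp
qed

lemma fox_mult: "fox j (u \<otimes>\<^bsub>free_group n\<^esub> v) = fox j u + q_pow (word_deg u) * fox j v"
  by (induction u) (simp_all add: free_group_def fox_push q_pow_add algebra_simps)

lemma fox_inv:
  assumes "u \<in> carrier (free_group n)"
  shows "fox j (inv\<^bsub>free_group n\<^esub> u) = - q_pow (- word_deg u) * fox j u"
proof -
  interpret F: group "free_group n" by (rule group_free_group)
  have "fox j (inv\<^bsub>free_group n\<^esub> u) + q_pow (- word_deg u) * fox j u = fox j \<one>\<^bsub>free_group n\<^esub>"
    using assms fox_mult[where u = "inv\<^bsub>free_group n\<^esub> u" and v = u and n = n and j = j] by (simp add: word_deg_inv)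
  then show ?thesis by (simp add: free_group_def add_eq_0_iff2)
qed

lemma fox_xgen: "fox j (xgen i) = (if i = j then 1 else 0)"
  by (simp add: xgen_def letter_fox_def)


section \<open>The chain rule\<close>

lemma xgen_inverse:
  assumes "i < n"
  shows "inv\<^bsub>free_group n\<^esub> (xgen i) = [(i, False)]"
proof -
  interpret F: group "free_group n" by (rule group_free_group)
  show ?thesis
    using assms
    by (intro F.inv_equality) (auto simp: free_group_def xgen_def linv_def reduced_Cons)
qed

lemma free_group_Cons:
  assumes "a # w \<in> carrier (free_group n)"
  shows "a # w = [a] \<otimes>\<^bsub>free_group n\<^esub> w" "[a] \<in> carrier (free_group n)"
    "w \<in> carrier (free_group n)" "fst a < n"
  using assms by (cases w; auto simp: free_group_def reduced_Cons)+

text \<open>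
  The exponent sum is a homomorphism to the integers, so agreement on the generators suffices.
\<close>

lemma word_deg_hom_image:
  assumes \<phi>: "\<phi> \<in> hom (free_group n) (free_group n)"
    and deg: "\<And>i. i < n \<Longrightarrow> word_deg (\<phi> (xgen i)) = 1"
    and w: "w \<in> carrier (free_group n)"
  shows "word_deg (\<phi> w) = word_deg w"
proof -
  interpret F: group "free_group n" by (rule group_free_group)
  interpret \<phi>: group_hom "free_group n" "free_group n" \<phi> by unfold_locales (rule \<phi>)
  have letter: "word_deg (\<phi> [a]) = letter_deg a" if "fst a < n" for a
  proof (cases a)
    case (Pair i e)
    show ?thesis
    proof (cases e)
      case True
      then show ?thesis using deg[of i] that Pair by (simp add: xgen_def letter_deg_def)
    next
      case False
      then have "[a] = inv\<^bsub>free_group n\<^esub> (xgen i)" using that Pair by (simp add: xgen_inverse)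
      then have "word_deg (\<phi> [a]) = - word_deg (\<phi> (xgen i))"
        using that Pair by (simp add: xgen_closed word_deg_inv)
      then show ?thesis using False that Pair deg[of i] by (simp add: letter_deg_def)
    qed
  qed
  show ?thesis using w
  proof (induction w)
    case Nil
    then show ?case using \<phi>.hom_one by (simp add: free_group_def)
  next
    case (Cons a w)
    note c = free_group_Cons[OF Cons.prems]
    have "\<phi> (a # w) = \<phi> [a] \<otimes>\<^bsub>free_group n\<^esub> \<phi> w"
      using c by (metis \<phi>.hom_mult)
    then show ?case using Cons.IH c letter by (simp add: word_deg_mult)
  qed
qed

text \<open>
  Both sides satisfy the same product rule in \<open>w\<close>: on the left \<open>\<phi>\<close> introduces the factor
  $q^{\deg \phi(u)}$, on the right the factor is $q^{\deg u}$, and these agree because \<open>\<phi>\<close>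
  preserves exponent sums. Hence it is enough to compare single letters.
\<close>

lemma fox_chain_rule:
  assumes \<phi>: "\<phi> \<in> hom (free_group n) (free_group n)"
    and deg: "\<And>i. i < n \<Longrightarrow> word_deg (\<phi> (xgen i)) = 1"
    and w: "w \<in> carrier (free_group n)"
  shows "fox j (\<phi> w) = (\<Sum>k<n. fox j (\<phi> (xgen k)) * fox k w)"
proof -
  interpret F: group "free_group n" by (rule group_free_group)
  interpret \<phi>: group_hom "free_group n" "free_group n" \<phi> by unfold_locales (rule \<phi>)
  have letter: "fox j (\<phi> [a]) = (\<Sum>k<n. fox j (\<phi> (xgen k)) * letter_fox k a)"
    if "fst a < n" for a
  proof (cases a)
    case (Pair i e)
    have "(\<Sum>k<n. fox j (\<phi> (xgen k)) * letter_fox k a) =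
        (\<Sum>k<n. if k = i then fox j (\<phi> (xgen i)) * (if e then 1 else - q_pow (- 1)) else 0)"
      by (rule sum.cong) (auto simp: letter_fox_def Pair)
    also have "\<dots> = fox j (\<phi> (xgen i)) * (if e then 1 else - q_pow (- 1))"
      using that Pair by simp
    also have "\<dots> = fox j (\<phi> [a])"
    proof (cases e)
      case True
      then show ?thesis by (simp add: xgen_def Pair)
    next
      case False
      then have "[a] = inv\<^bsub>free_group n\<^esub> (xgen i)" using that Pair by (simp add: xgen_inverse)
      then show ?thesis
        using False that Pair deg[of i] by (simp add: xgen_closed fox_inv mult.commute)
    qed
    finally show ?thesis by simp
  qed
  show ?thesis using w
  proof (induction w)
    case Nil
    then show ?case using \<phi>.hom_one by (simp add: free_group_def)
  next
    case (Cons a w)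
    note c = free_group_Cons[OF Cons.prems]
    have "\<phi> (a # w) = \<phi> [a] \<otimes>\<^bsub>free_group n\<^esub> \<phi> w"
      using c by (metis \<phi>.hom_mult)
    moreover have "word_deg (\<phi> [a]) = letter_deg a"
      using word_deg_hom_image[OF \<phi> deg c(2)] by simp
    ultimately show ?case
      using Cons.IH[OF c(3)] letter[OF c(4)]
      by (simp add: fox_mult sum.distrib sum_distrib_left algebra_simps)
  qed
qed


section \<open>The Magnus representation of the conjugating automorphisms\<close>

text \<open>
  This is the transpose of the usual Fox Jacobian, which has the gradients as rows; transposing
  makes the matrix act on vectors from the left.
\<close>

definition magnus_mat :: "nat \<Rightarrow> (fword \<Rightarrow> fword) \<Rightarrow> laurent mat" where
  "magnus_mat n \<phi> = mat n n (\<lambda>(j, i). fox j (\<phi> (xgen i)))"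

definition magnus :: "nat \<Rightarrow> (fword \<Rightarrow> fword) \<Rightarrow> laurent vec \<Rightarrow> laurent vec" where
  "magnus n \<phi> = (\<lambda>v\<in>W n. magnus_mat n \<phi> *\<^sub>v v)"

lemma magnus_mat_carrier [simp]: "magnus_mat n \<phi> \<in> carrier_mat n n"
  by (simp add: magnus_mat_def)

lemma magnus_mat_mult_closed: "v \<in> W n \<Longrightarrow> magnus_mat n \<phi> *\<^sub>v v \<in> W n"
  unfolding W_def by (rule mult_mat_vec_carrier[OF magnus_mat_carrier])

lemma magnus_wgen:
  assumes "i < n"
  shows "magnus n \<phi> (wgen n i) = vec n (\<lambda>j. fox j (\<phi> (xgen i)))"
  using assms
  by (auto simp: magnus_def magnus_mat_def W_def wgen_def intro!: eq_vecI)

text \<open>Exponent sums are invariant under conjugation.\<close>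

lemma word_deg_conj_aut:
  assumes "\<phi> \<in> conj_auts n" and "i < n"
  shows "word_deg (\<phi> (xgen i)) = 1"
proof -
  obtain \<pi> f where "f i \<in> carrier (free_group n)"
    and "\<phi> (xgen i) = inv\<^bsub>free_group n\<^esub> (f i) \<otimes>\<^bsub>free_group n\<^esub> xgen (\<pi> i) \<otimes>\<^bsub>free_group n\<^esub> f i"
    using assms unfolding conj_auts_def by blast
  then show ?thesis by (simp add: word_deg_mult word_deg_inv word_deg_xgen)
qed

lemma conj_aut_auto: "\<phi> \<in> conj_auts n \<Longrightarrow> \<phi> \<in> auto (free_group n)"
  by (simp add: conj_auts_def Aut_free_carrier)

lemma magnus_mat_compose:
  assumes \<phi>: "\<phi> \<in> hom (free_group n) (free_group n)" and \<chi>: "\<chi> \<in> conj_auts n"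
  shows "magnus_mat n (compose (carrier (free_group n)) \<chi> \<phi>) =
    magnus_mat n \<chi> * magnus_mat n \<phi>"
proof (rule eq_matI)
  fix j i assume "j < dim_row (magnus_mat n \<chi> * magnus_mat n \<phi>)"
    and "i < dim_col (magnus_mat n \<chi> * magnus_mat n \<phi>)"
  then have ji: "j < n" "i < n" by (simp_all add: magnus_mat_def)
  have "\<chi> \<in> hom (free_group n) (free_group n)"
    using conj_aut_auto[OF \<chi>] by (simp add: auto_def)
  moreover have "\<phi> (xgen i) \<in> carrier (free_group n)"
    using \<phi> ji by (auto simp: hom_def xgen_closed)
  ultimately have "fox j (\<chi> (\<phi> (xgen i))) =
      (\<Sum>k<n. fox j (\<chi> (xgen k)) * fox k (\<phi> (xgen i)))"
    by (intro fox_chain_rule word_deg_conj_aut[OF \<chi>])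
  then show "magnus_mat n (compose (carrier (free_group n)) \<chi> \<phi>) $$ (j, i) =
      (magnus_mat n \<chi> * magnus_mat n \<phi>) $$ (j, i)"
    using ji
    by (simp add: magnus_mat_def scalar_prod_def compose_eq xgen_closed lessThan_atLeast0)
qed (simp_all add: magnus_mat_def)

lemma magnus_mat_mult:
  assumes \<phi>: "\<phi> \<in> carrier (conj_group n)" and \<chi>: "\<chi> \<in> carrier (conj_group n)"
  shows "magnus_mat n (\<phi> \<otimes>\<^bsub>conj_group n\<^esub> \<chi>) = magnus_mat n \<chi> * magnus_mat n \<phi>"
proof -
  have "\<phi> \<in> conj_auts n" "\<chi> \<in> conj_auts n"
    using assms by (simp_all add: conj_group_def)
  then show ?thesis
    using magnus_mat_compose[of \<phi> n \<chi>] conj_aut_auto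
    by (simp add: conj_group_def Aut_free_mult auto_def)
qed

lemma magnus_mat_one: "magnus_mat n \<one>\<^bsub>conj_group n\<^esub> = 1\<^sub>m n"
  by (rule eq_matI)
    (auto simp: conj_group_def Aut_free_one magnus_mat_def xgen_closed fox_xgen)

lemma magnus_closed:
  assumes \<phi>: "\<phi> \<in> carrier (conj_group n)"
  shows "magnus n \<phi> \<in> carrier (GL n)"
proof -
  interpret C: group "conj_group n" by (rule group_conj_group)
  have \<phi>': "inv\<^bsub>conj_group n\<^esub> \<phi> \<in> carrier (conj_group n)"
    using \<phi> by simp
  have inverse: "magnus_mat n \<phi> * magnus_mat n (inv\<^bsub>conj_group n\<^esub> \<phi>) = 1\<^sub>m n"
    "magnus_mat n (inv\<^bsub>conj_group n\<^esub> \<phi>) * magnus_mat n \<phi> = 1\<^sub>m n"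
    using \<phi> \<phi>' by (simp_all flip: magnus_mat_mult add: magnus_mat_one)
  have cancel: "A *\<^sub>v (B *\<^sub>v v) = v"
    if "A * B = 1\<^sub>m n" "A \<in> carrier_mat n n" "B \<in> carrier_mat n n" "v \<in> W n" for A B v
    using that by (simp add: W_def flip: assoc_mult_mat_vec)
  have "bij_betw (magnus n \<phi>) (W n) (W n)"
    by (rule bij_betwI[of _ _ _ "\<lambda>v. magnus_mat n (inv\<^bsub>conj_group n\<^esub> \<phi>) *\<^sub>v v"])
      (simp_all add: magnus_def magnus_mat_mult_closed cancel inverse)
  moreover have "magnus n \<phi> (u + v) = magnus n \<phi> u + magnus n \<phi> v"
    if "u \<in> W n" "v \<in> W n" for u v
    using that by (simp add: magnus_def W_def mult_add_distrib_mat_vec[OF magnus_mat_carrier])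
  moreover have "magnus n \<phi> (a \<cdot>\<^sub>v v) = a \<cdot>\<^sub>v magnus n \<phi> v" if "v \<in> W n" for a v
    using that by (auto simp: magnus_def W_def magnus_mat_def intro!: eq_vecI)
  ultimately show ?thesis
    by (simp add: GL_def Bij_def magnus_def)
qed

lemma magnus_hom: "magnus n \<in> hom (conj_group n) (GL n)"
proof (rule homI)
  fix \<phi> \<chi> assume \<phi>: "\<phi> \<in> carrier (conj_group n)" and \<chi>: "\<chi> \<in> carrier (conj_group n)"
  have "magnus n \<phi> \<in> Bij (W n)" "magnus n \<chi> \<in> Bij (W n)"
    using \<phi> \<chi> by (auto dest: magnus_closed simp: GL_def)
  then have "magnus n \<phi> \<otimes>\<^bsub>GL n\<^esub> magnus n \<chi> = compose (W n) (magnus n \<chi>) (magnus n \<phi>)"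
    by (simp add: GL_def opposite_group_def BijGroup_def)
  also have "\<dots> = magnus n (\<phi> \<otimes>\<^bsub>conj_group n\<^esub> \<chi>)"
  proof (rule extensionalityI[of _ "W n"])
    fix v assume v: "v \<in> W n"
    then show "compose (W n) (magnus n \<chi>) (magnus n \<phi>) v = magnus n (\<phi> \<otimes>\<^bsub>conj_group n\<^esub> \<chi>) v"
      using assoc_mult_mat_vec[OF magnus_mat_carrier magnus_mat_carrier]
      by (simp add: compose_eq magnus_def magnus_mat_mult_closed magnus_mat_mult[OF \<phi> \<chi>])
        (simp add: W_def)
  qed (simp_all add: magnus_def)
  finally show "magnus n (\<phi> \<otimes>\<^bsub>conj_group n\<^esub> \<chi>) = magnus n \<phi> \<otimes>\<^bsub>GL n\<^esub> magnus n \<chi>" ..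
qed (rule magnus_closed)


section \<open>Restriction to the braid group\<close>

lemma magnus_braid_gen:
  assumes i: "Suc i < n"
  shows "magnus n (braid_gen n i) (wgen n i) = (1 - q) \<cdot>\<^sub>v wgen n i + q \<cdot>\<^sub>v wgen n (Suc i)"
    and "magnus n (braid_gen n i) (wgen n (Suc i)) = wgen n i"
    and "\<lbrakk>l < n; l \<noteq> i; l \<noteq> Suc i\<rbrakk> \<Longrightarrow> magnus n (braid_gen n i) (wgen n l) = wgen n l"
proof -
  have "fox j (braid_gen n i (xgen i)) =
      (1 - q) * (if i = j then 1 else 0) + q * (if Suc i = j then 1 else 0)" for j
    using i
    by (simp add: braid_gen_xgen[OF i] fox_mult fox_inv xgen_closed word_deg_mult word_deg_xgen
        fox_xgen q_pow_1 algebra_simps flip: q_pow_add)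
  then show "magnus n (braid_gen n i) (wgen n i) =
      (1 - q) \<cdot>\<^sub>v wgen n i + q \<cdot>\<^sub>v wgen n (Suc i)"
    using i by (subst magnus_wgen) (auto simp: wgen_def unit_vec_def intro!: eq_vecI)
  show "magnus n (braid_gen n i) (wgen n (Suc i)) = wgen n i"
    using i by (subst magnus_wgen)
      (auto simp: braid_gen_xgen[OF i] fox_xgen wgen_def unit_vec_def intro!: eq_vecI)
  show "magnus n (braid_gen n i) (wgen n l) = wgen n l" if "l < n" "l \<noteq> i" "l \<noteq> Suc i"
    using that by (subst magnus_wgen)
      (auto simp: braid_gen_xgen[OF i] fox_xgen wgen_def unit_vec_def intro!: eq_vecI)
qed

lemma is_burau_restrict_magnus:
  "is_burau n (restrict (magnus n) (carrier (braid_group n)))"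
proof -
  have sub: "carrier (braid_group n) \<subseteq> carrier (conj_group n)"
    by (rule subgroup.subset[OF subgroup_braid_group])
  have mult: "x \<otimes>\<^bsub>braid_group n\<^esub> y = x \<otimes>\<^bsub>conj_group n\<^esub> y" for x y
    by (simp add: braid_group_def)
  interpret B: group "braid_group n" by (rule group_braid_group)
  have "restrict (magnus n) (carrier (braid_group n)) \<in> hom (braid_group n) (GL n)"
  proof (rule homI)
    fix x y assume xy: "x \<in> carrier (braid_group n)" "y \<in> carrier (braid_group n)"
    then have "x \<otimes>\<^bsub>conj_group n\<^esub> y \<in> carrier (braid_group n)"
      using B.m_closed[OF xy] by (simp add: mult)
    then show "restrict (magnus n) (carrier (braid_group n)) (x \<otimes>\<^bsub>braid_group n\<^esub> y) =
        restrict (magnus n) (carrier (braid_group n)) x \<otimes>\<^bsub>GL n\<^esub>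
        restrict (magnus n) (carrier (braid_group n)) y"
      using xy sub hom_mult[OF magnus_hom[of n], of x y] by (auto simp: mult)
  qed (use sub magnus_closed in auto)
  moreover have "braid_gen n i \<in> carrier (braid_group n)" if "Suc i < n" for i
    using that by (auto simp: braid_group_def intro: generate.incl)
  ultimately show ?thesis
    by (auto simp: is_burau_def magnus_braid_gen)
qed

theorem proposition5p1:
  fixes n :: nat
  assumes "n \<ge> 2"
  shows "\<exists>\<psi>'. \<psi>' \<in> hom (conj_group n) (GL n) \<and>
    restrict \<psi>' (carrier (braid_group n)) = burau n"
proof (intro exI conjI)
  show "magnus n \<in> hom (conj_group n) (GL n)" by (rule magnus_hom)
  show "restrict (magnus n) (carrier (braid_group n)) = burau n"
    unfolding burau_def
    by (rule the_equality[symmetric])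
      (use is_burau_restrict_magnus is_burau_unique in \<open>auto simp del: restrict_apply\<close>)
qed

end
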